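(* Let $A \in \mathbb{R}^{n \times n}$ be symmetric and positive-definite, with rows $A_1,\dots,A_n$. Choose a random index $i \in \{1,\dots,n\}$ with probability proportional to $A_{ii}^2$, i.e. $\mathbb{P}(i = j) = A_{jj}^2 / \sum_{\ell=1}^n A_{\ell\ell}^2$ for $1 \le j \le n$, and let $$B = A - \frac{A_i^{T} A_i}{A_{ii}}.$$ Then $$ \mathbb{E} \| B\|_F^2 \leq \|A\|_F^2 - \frac{1}{\sum_{i=1}^{n} A_{ii}^2} \sum_{i=1}^{n} \|A_{i}\|_{\ell^2}^{4} \leq \left( 1 - \frac{1}{n} \right) \|A\|_{F}^2 .$$
   Context: $A_i$ denotes the $i$-th row of $A$, viewed as a $1\times n$ row vector, so that $A_i^T A_i$ is an $n \times n$ rank-one matrix with entries $(A_i^TA_i)_{jk} = A_{ij}A_{ik}$. $\|A_i\|_{\ell^2}$ is the Euclidean norm of that row and $\|\cdot\|_F$ is the Frobenius norm. The expectation is over the random choice of the index $i$. The matrix $B$ is the residual after one step of the randomly pivoted partial Cholesky algorithm with pivot $i$. *)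

theory Defs
  imports "HOL-Probability.Probability"
begin

definition symmetric_matrix :: "real^'n^'n \<Rightarrow> bool" where
  "symmetric_matrix A \<longleftrightarrow> transpose A = A"

definition positive_definite :: "real^'n^'n \<Rightarrow> bool" where
  "positive_definite A \<longleftrightarrow> (\<forall>x. x \<noteq> 0 \<longrightarrow> x \<bullet> (A *v x) > 0)"

definition frobenius_norm :: "real^'n^'m \<Rightarrow> real" where
  "frobenius_norm A = sqrt (\<Sum>i\<in>UNIV. \<Sum>j\<in>UNIV. (A $ i $ j)\<^sup>2)"

lemma frobenius_norm_eq_norm: "frobenius_norm A = norm A"
  by (simp add: frobenius_norm_def norm_vec_def L2_set_def sum_nonneg)

definition row_matrix :: "'m \<Rightarrow> real^'n^'m \<Rightarrow> real^'n^1" where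
  "row_matrix i A = rowvector (row i A)"

definition cholesky_residual :: "real^'n^'n \<Rightarrow> 'n \<Rightarrow> real^'n^'n" where
  "cholesky_residual A i =
     A - (1 / A $ i $ i) *\<^sub>R (transpose (row_matrix i A) ** row_matrix i A)"

lemma cholesky_residual_nth:
  "cholesky_residual A i $ j $ k = A $ j $ k - A $ i $ j * A $ i $ k / A $ i $ i"
  by (simp add: cholesky_residual_def row_matrix_def rowvector_def row_def
      transpose_def matrix_matrix_mult_def)

end

theory Submission
  imports Defs
begin

text \<open>
  Write \<open>a\<close> for the pivot row \<open>A\<^sub>i\<close> and \<open>S = \<Sum>\<^sub>l A\<^sub>l\<^sub>l\<^sup>2\<close>. Expanding the square of the Frobenius
  norm of the residual gives
  \<open>\<parallel>B\<parallel>\<^sup>2 = \<parallel>A\<parallel>\<^sup>2 - 2 (a \<bullet> A a) / A\<^sub>i\<^sub>i + \<parallel>a\<parallel>\<^sup>4 / A\<^sub>i\<^sub>i\<^sup>2\<close> (\<open>frobenius_cholesky_residual\<close>).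
  As \<open>a = A e\<^sub>i\<close> by symmetry, \<open>\<parallel>a\<parallel>\<^sup>2 = a \<bullet> A e\<^sub>i\<close>, and the Cauchy--Schwarz inequality for the
  inner product \<open>x \<bullet> A y\<close> (\<open>positive_definite_Cauchy_Schwarz\<close>) yields \<open>\<parallel>a\<parallel>\<^sup>4 \<le> A\<^sub>i\<^sub>i (a \<bullet> A a)\<close>.
  Thus the cross term is at least twice the last term, and
  \<open>\<parallel>B\<parallel>\<^sup>2 \<le> \<parallel>A\<parallel>\<^sup>2 - \<parallel>a\<parallel>\<^sup>4 / A\<^sub>i\<^sub>i\<^sup>2\<close> for every single pivot. The sampling weights \<open>A\<^sub>i\<^sub>i\<^sup>2 / S\<close> cancel
  the denominators \<open>A\<^sub>i\<^sub>i\<^sup>2\<close>, so averaging turns this into the first inequality.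

  For the second one, \<open>\<parallel>A\<parallel>\<^sup>2 = \<Sum>\<^sub>i \<parallel>A\<^sub>i\<parallel>\<^sup>2\<close>, so the Cauchy--Schwarz inequality in the
  \<open>n\<close>-dimensional space gives \<open>\<parallel>A\<parallel>\<^sup>4 \<le> n \<Sum>\<^sub>i \<parallel>A\<^sub>i\<parallel>\<^sup>4\<close>, while \<open>S \<le> \<parallel>A\<parallel>\<^sup>2\<close> because \<open>S\<close> keeps only
  the diagonal entries; one factor \<open>\<parallel>A\<parallel>\<^sup>2\<close> cancels.
\<close>

text \<open>
  The quadratic form is nonnegative at \<open>y - t x\<close>; the value \<open>t = (x \<bullet> A y) / (x \<bullet> A x)\<close>
  minimises it.
\<close>

lemma positive_definite_Cauchy_Schwarz:
  fixes A :: "real^'n^'n"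
  assumes sym: "symmetric_matrix A" and pd: "positive_definite A"
  shows "(x \<bullet> (A *v y))\<^sup>2 \<le> (x \<bullet> (A *v x)) * (y \<bullet> (A *v y))"
proof (cases "x = 0")
  case True
  then show ?thesis by simp
next
  case False
  define p where "p = x \<bullet> (A *v x)"
  define q where "q = x \<bullet> (A *v y)"
  have p: "p > 0"
    using pd False by (simp add: positive_definite_def p_def)
  have nonneg: "z \<bullet> (A *v z) \<ge> 0" for z
    using pd by (cases "z = 0") (auto simp: positive_definite_def less_imp_le)
  have q': "y \<bullet> (A *v x) = q"
    using sym by (metis dot_lmul_matrix inner_commute q_def symmetric_matrix_def
        transpose_matrix_vector)
  define t where "t = q / p"
  have "0 \<le> (y - t *\<^sub>R x) \<bullet> (A *v (y - t *\<^sub>R x))"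
    by (rule nonneg)
  also have "\<dots> = y \<bullet> (A *v y) - 2 * t * q + t\<^sup>2 * p"
    by (simp add: matrix_vector_mult_diff_distrib matrix_vector_mult_scaleR inner_diff_left
        inner_diff_right q' flip: p_def q_def)
      (simp add: algebra_simps power2_eq_square)
  also have "\<dots> = y \<bullet> (A *v y) - q\<^sup>2 / p"
    using p by (simp add: t_def field_simps power2_eq_square)
  finally show ?thesis
    using p by (simp add: field_simps flip: p_def q_def)
qed

lemma positive_definite_diag_pos:
  fixes A :: "real^'n^'n"
  assumes "positive_definite A"
  shows "A $ i $ i > 0"
proof -
  have "axis i 1 \<bullet> (A *v axis i 1) > 0"
    using assms by (simp add: positive_definite_def axis_eq_0_iff)
  then show ?thesis
    by (simp add: matrix_vector_mult_basis inner_axis' column_def)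
qed

text \<open>This is \<open>(e\<^sub>i \<bullet> A\<^sup>2 e\<^sub>i)\<^sup>2 \<le> (e\<^sub>i \<bullet> A e\<^sub>i) (e\<^sub>i \<bullet> A\<^sup>3 e\<^sub>i)\<close>, an instance of Cauchy--Schwarz.\<close>

lemma norm_row_power4_le:
  fixes A :: "real^'n^'n"
  assumes sym: "symmetric_matrix A" and pd: "positive_definite A"
  shows "norm (row i A) ^ 4 \<le> A $ i $ i * (row i A \<bullet> (A *v row i A))"
proof -
  have col: "A *v axis i 1 = row i A"
    using sym by (metis column_transpose matrix_vector_mult_basis symmetric_matrix_def)
  have diag: "axis i 1 \<bullet> (A *v axis i 1) = A $ i $ i"
    by (simp add: matrix_vector_mult_basis inner_axis' column_def)
  have "norm (row i A) ^ 4 = (row i A \<bullet> (A *v axis i 1))\<^sup>2"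
    by (simp add: col power2_norm_eq_inner[symmetric])
  also have "\<dots> \<le> (row i A \<bullet> (A *v row i A)) * (axis i 1 \<bullet> (A *v axis i 1))"
    by (rule positive_definite_Cauchy_Schwarz[OF sym pd])
  finally show ?thesis
    by (simp add: diag mult.commute)
qed

lemma frobenius_norm_squared_rows:
  "(frobenius_norm A)\<^sup>2 = (\<Sum>i\<in>UNIV. (norm (row i A))\<^sup>2)"
  by (simp add: frobenius_norm_def sum_nonneg row_def power2_norm_eq_inner inner_vec_def
      power2_eq_square[symmetric])

lemma frobenius_cholesky_residual:
  fixes A :: "real^'n^'n"
  shows "(frobenius_norm (cholesky_residual A i))\<^sup>2 =
    (frobenius_norm A)\<^sup>2 - 2 * (row i A \<bullet> (A *v row i A)) / A $ i $ i
      + norm (row i A) ^ 4 / (A $ i $ i)\<^sup>2"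
proof -
  define a where "a = row i A"
  define c where "c = 1 / A $ i $ i"
  have "(frobenius_norm (cholesky_residual A i))\<^sup>2 =
      (\<Sum>j\<in>UNIV. \<Sum>k\<in>UNIV. (A $ j $ k - c * (a $ j * a $ k))\<^sup>2)"
    by (simp add: frobenius_norm_def sum_nonneg cholesky_residual_nth a_def c_def row_def)
  also have "\<dots> = (\<Sum>j\<in>UNIV. \<Sum>k\<in>UNIV. (A $ j $ k)\<^sup>2)
      - 2 * c * (\<Sum>j\<in>UNIV. \<Sum>k\<in>UNIV. a $ j * (A $ j $ k * a $ k))
      + c\<^sup>2 * (\<Sum>j\<in>UNIV. \<Sum>k\<in>UNIV. (a $ j)\<^sup>2 * (a $ k)\<^sup>2)"
    by (simp add: power2_diff power_mult_distrib sum.distrib sum_subtractf sum_distrib_left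
        algebra_simps)
  also have "(\<Sum>j\<in>UNIV. \<Sum>k\<in>UNIV. (A $ j $ k)\<^sup>2) = (frobenius_norm A)\<^sup>2"
    by (simp add: frobenius_norm_def sum_nonneg)
  also have "(\<Sum>j\<in>UNIV. \<Sum>k\<in>UNIV. a $ j * (A $ j $ k * a $ k)) = a \<bullet> (A *v a)"
    by (simp add: inner_vec_def matrix_vector_mult_def sum_distrib_left)
  also have "(\<Sum>j\<in>UNIV. \<Sum>k\<in>UNIV. (a $ j)\<^sup>2 * (a $ k)\<^sup>2) = norm a ^ 4"
  proof -
    have "norm a ^ 4 = (norm a)\<^sup>2 * (norm a)\<^sup>2"
      by (simp flip: power_add)
    also have "(norm a)\<^sup>2 = (\<Sum>j\<in>UNIV. (a $ j)\<^sup>2)"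
      by (simp only: power2_norm_eq_inner) (simp add: inner_vec_def power2_eq_square)
    finally show ?thesis
      by (simp add: sum_product)
  qed
  finally show ?thesis
    by (simp add: a_def c_def power_divide)
qed

lemma frobenius_cholesky_residual_le:
  fixes A :: "real^'n^'n"
  assumes "symmetric_matrix A" and "positive_definite A"
  shows "(frobenius_norm (cholesky_residual A i))\<^sup>2
    \<le> (frobenius_norm A)\<^sup>2 - norm (row i A) ^ 4 / (A $ i $ i)\<^sup>2"
proof -
  have d: "A $ i $ i > 0"
    by (rule positive_definite_diag_pos) fact
  have "norm (row i A) ^ 4 / (A $ i $ i)\<^sup>2
      \<le> A $ i $ i * (row i A \<bullet> (A *v row i A)) / (A $ i $ i)\<^sup>2"
    by (intro divide_right_mono norm_row_power4_le assms) simp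
  also have "\<dots> = (row i A \<bullet> (A *v row i A)) / A $ i $ i"
    using d by (simp add: power2_eq_square)
  finally show ?thesis
    unfolding frobenius_cholesky_residual by simp
qed

lemma (in prob_space) expectation_finite_range:
  fixes X :: "'a \<Rightarrow> 'n::finite" and f :: "'n \<Rightarrow> real"
  assumes X: "X \<in> M \<rightarrow>\<^sub>M count_space UNIV"
  shows "expectation (\<lambda>w. f (X w)) = (\<Sum>j\<in>UNIV. f j * prob {w \<in> space M. X w = j})"
proof -
  have sets: "{w \<in> space M. X w = j} \<in> events" for j
    using measurable_sets[OF X, of "{j}"] by (simp add: vimage_def Int_def conj_commute)
  have "expectation (\<lambda>w. f (X w)) =
      expectation (\<lambda>w. \<Sum>j\<in>UNIV. f j * indicator {w \<in> space M. X w = j} w)"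
    by (intro Bochner_Integration.integral_cong) (auto simp: indicator_def if_distrib cong: if_cong)
  also have "\<dots> = (\<Sum>j\<in>UNIV. f j * prob {w \<in> space M. X w = j})"
    using sets by (subst Bochner_Integration.integral_sum)
      (auto simp: emeasure_eq_measure intro!: integrable_mult_right integrable_real_indicator)
  finally show ?thesis .
qed

lemma diag_squares_le_frobenius:
  fixes A :: "real^'n^'n"
  shows "(\<Sum>i\<in>UNIV. (A $ i $ i)\<^sup>2) \<le> (frobenius_norm A)\<^sup>2"
proof -
  have "(\<Sum>i\<in>UNIV. (A $ i $ i)\<^sup>2) \<le> (\<Sum>i\<in>UNIV. \<Sum>j\<in>UNIV. (A $ i $ j)\<^sup>2)"
    by (intro sum_mono member_le_sum) auto
  then show ?thesis
    by (simp add: frobenius_norm_def sum_nonneg)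
qed

text \<open>Cauchy--Schwarz between the vector of squared row norms and the all-ones vector.\<close>

lemma frobenius_power4_le_sum_rows:
  fixes A :: "real^'n^'m"
  shows "((frobenius_norm A)\<^sup>2)\<^sup>2 \<le> real CARD('m) * (\<Sum>i\<in>UNIV. norm (row i A) ^ 4)"
  using Cauchy_Schwarz_ineq_sum[of "\<lambda>_. 1" "\<lambda>i. (norm (row i A))\<^sup>2" "UNIV :: 'm set"]
  by (simp add: frobenius_norm_squared_rows flip: power_mult)

theorem mainTheorem1:
  fixes A :: "real^'n^'n"
    and M :: "'w measure"
    and pivot :: "'w \<Rightarrow> 'n"
  assumes "symmetric_matrix A"
    and "positive_definite A"
    and "prob_space M"
    and "pivot \<in> M \<rightarrow>\<^sub>M count_space UNIV"
    and "\<And>j. measure M {w \<in> space M. pivot w = j} =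
           (A $ j $ j)\<^sup>2 / (\<Sum>l\<in>UNIV. (A $ l $ l)\<^sup>2)"
  shows "prob_space.expectation M (\<lambda>w. (frobenius_norm (cholesky_residual A (pivot w)))\<^sup>2)
           \<le> (frobenius_norm A)\<^sup>2
              - 1 / (\<Sum>i\<in>UNIV. (A $ i $ i)\<^sup>2) * (\<Sum>i\<in>UNIV. norm (row i A) ^ 4)
       \<and> (frobenius_norm A)\<^sup>2
              - 1 / (\<Sum>i\<in>UNIV. (A $ i $ i)\<^sup>2) * (\<Sum>i\<in>UNIV. norm (row i A) ^ 4)
           \<le> (1 - 1 / real CARD('n)) * (frobenius_norm A)\<^sup>2"
proof -
  interpret prob_space M by fact
  define S where "S = (\<Sum>i\<in>UNIV. (A $ i $ i)\<^sup>2)"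
  define R where "R = (\<Sum>i\<in>UNIV. norm (row i A) ^ 4)"
  define F where "F = (frobenius_norm A)\<^sup>2"
  note d = positive_definite_diag_pos[OF assms(2)]
  have S: "S > 0"
    unfolding S_def using d by (intro sum_pos) (auto simp: less_imp_neq[symmetric])
  have "expectation (\<lambda>w. (frobenius_norm (cholesky_residual A (pivot w)))\<^sup>2) =
      (\<Sum>j\<in>UNIV. (frobenius_norm (cholesky_residual A j))\<^sup>2 * ((A $ j $ j)\<^sup>2 / S))"
    unfolding S_def assms(5)[symmetric] by (rule expectation_finite_range[OF assms(4)])
  also have "\<dots> \<le> (\<Sum>j\<in>UNIV. (F - norm (row j A) ^ 4 / (A $ j $ j)\<^sup>2) * ((A $ j $ j)\<^sup>2 / S))"
    unfolding F_def using S
    by (intro sum_mono mult_right_mono frobenius_cholesky_residual_le assms) auto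
  also have "\<dots> = (\<Sum>j\<in>UNIV. F / S * (A $ j $ j)\<^sup>2 - norm (row j A) ^ 4 / S)"
    using S d by (intro sum.cong refl) (simp add: field_simps less_imp_neq[symmetric])
  also have "\<dots> = F / S * S - R / S"
    by (simp add: sum_subtractf S_def R_def sum_distrib_left sum_divide_distrib)
  also have "\<dots> = F - 1 / S * R"
    using S by simp
  finally have first: "expectation (\<lambda>w. (frobenius_norm (cholesky_residual A (pivot w)))\<^sup>2)
      \<le> F - 1 / S * R" .
  have "F * S \<le> F * F"
    unfolding F_def S_def by (intro mult_left_mono diag_squares_le_frobenius) simp
  also have "\<dots> \<le> real CARD('n) * R"
    using frobenius_power4_le_sum_rows[of A] by (simp add: F_def R_def power2_eq_square)
  finally have "F / real CARD('n) \<le> R / S"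
    using S by (simp add: field_simps)
  then have second: "F - 1 / S * R \<le> (1 - 1 / real CARD('n)) * F"
    by (simp add: algebra_simps)
  from first second show ?thesis
    unfolding F_def S_def R_def by blast
qed

end
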